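(* For every $\omega\in\Omega_+$, every finitely presented group admitting an epimorphism onto $G_\omega$ is large.
   Context: $\Omega=\{0,1,2\}^{\mathbf N}$, sequences $\omega=(\omega_1,\omega_2,\dots)$; $\Omega_+$ is the set of sequences that are not eventually constant; $\sigma$ is the shift $(\sigma\omega)_n=\omega_{n+1}$. On the binary tree $X^*$, $X=\{0,1\}$, let $a$ be the automorphism $a(0w)=1w$, $a(1w)=0w$. Set $a_{\beta(0)}=a_{\beta(1)}=a$, $a_{\beta(2)}=1$; $a_{\gamma(0)}=a_{\gamma(2)}=a$, $a_{\gamma(1)}=1$; $a_{\delta(1)}=a_{\delta(2)}=a$, $a_{\delta(0)}=1$. For each $\omega$, define automorphisms $b_\omega,c_\omega,d_\omega$ of $X^*$ recursively by $b_\omega(0w)=0\,a_{\beta(\omega_1)}(w)$, $b_\omega(1w)=1\,b_{\sigma\omega}(w)$, and similarly $c_\omega$ with $a_{\gamma(\omega_1)},c_{\sigma\omega}$, and $d_\omega$ with $a_{\delta(\omega_1)},d_{\sigma\omega}$. $G_\omega=\langle a,b_\omega,c_\omega,d_\omega\rangle$. (E.g. $\omega=012012\dots$ gives the Grigorchuk group.) A group is large if it has a finite-index subgroup admitting an epimorphism onto a non-abelian free group. *)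

theory Defs
  imports "HOL-Algebra.Algebra"
begin

text \<open>omega is indexed from 0: (omega 0) is the paper's omega_1.\<close>

definition Omega :: "(nat \<Rightarrow> nat) set" where
  "Omega = {w. \<forall>n. w n \<le> 2}"

definition Omega_plus :: "(nat \<Rightarrow> nat) set" where
  "Omega_plus = {w \<in> Omega. \<not> (\<exists>N c. \<forall>n\<ge>N. w n = c)}"

definition shift :: "(nat \<Rightarrow> nat) \<Rightarrow> (nat \<Rightarrow> nat)" where
  "shift w = (\<lambda>n. w (Suc n))"

section \<open>Automorphisms of the binary tree X^*, X = {0,1}; False = 0, True = 1\<close>

fun tree_a :: "bool list \<Rightarrow> bool list" where
  "tree_a [] = []"
| "tree_a (x # v) = (\<not> x) # v"

text \<open>Generic recursive automorphism: P i holds iff the section a_{.(i)} equals a.\<close>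
fun tree_gen :: "(nat \<Rightarrow> bool) \<Rightarrow> (nat \<Rightarrow> nat) \<Rightarrow> bool list \<Rightarrow> bool list" where
  "tree_gen P w [] = []"
| "tree_gen P w (False # v) = False # (if P (w 0) then tree_a v else v)"
| "tree_gen P w (True # v) = True # tree_gen P (shift w) v"

definition tree_b :: "(nat \<Rightarrow> nat) \<Rightarrow> bool list \<Rightarrow> bool list" where
  "tree_b w = tree_gen (\<lambda>i. i = 0 \<or> i = 1) w"

definition tree_c :: "(nat \<Rightarrow> nat) \<Rightarrow> bool list \<Rightarrow> bool list" where
  "tree_c w = tree_gen (\<lambda>i. i = 0 \<or> i = 2) w"

definition tree_d :: "(nat \<Rightarrow> nat) \<Rightarrow> bool list \<Rightarrow> bool list" where
  "tree_d w = tree_gen (\<lambda>i. i = 1 \<or> i = 2) w"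

definition G_omega :: "(nat \<Rightarrow> nat) \<Rightarrow> (bool list \<Rightarrow> bool list) monoid" where
  "G_omega w = subgroup_generated (BijGroup (UNIV :: bool list set))
                 {tree_a, tree_b w, tree_c w, tree_d w}"

definition letter_val :: "('a, 'b) monoid_scheme \<Rightarrow> 'a \<times> bool \<Rightarrow> 'a" where
  "letter_val G l = (if snd l then inv\<^bsub>G\<^esub> (fst l) else fst l)"

definition word_val :: "('a, 'b) monoid_scheme \<Rightarrow> ('a \<times> bool) list \<Rightarrow> 'a" where
  "word_val G ws = foldr (\<lambda>l y. letter_val G l \<otimes>\<^bsub>G\<^esub> y) ws \<one>\<^bsub>G\<^esub>"

definition words_over :: "'a set \<Rightarrow> ('a \<times> bool) list set" where
  "words_over S = {ws. set ws \<subseteq> S \<times> UNIV}"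

definition letter_inv :: "'a \<times> bool \<Rightarrow> 'a \<times> bool" where
  "letter_inv l = (fst l, \<not> snd l)"

fun reduced_word :: "('a \<times> bool) list \<Rightarrow> bool" where
  "reduced_word [] = True"
| "reduced_word [l] = True"
| "reduced_word (l # m # ws) = (m \<noteq> letter_inv l \<and> reduced_word (m # ws))"

inductive pres_equiv :: "('a \<times> bool) list set \<Rightarrow> ('a \<times> bool) list \<Rightarrow> ('a \<times> bool) list \<Rightarrow> bool"
  for R where
  refl: "pres_equiv R u u"
| sym: "pres_equiv R u v \<Longrightarrow> pres_equiv R v u"
| trans: "pres_equiv R u v \<Longrightarrow> pres_equiv R v w \<Longrightarrow> pres_equiv R u w"
| cancel: "pres_equiv R (u @ v) (u @ [l, letter_inv l] @ v)"
| relator: "r \<in> R \<Longrightarrow> pres_equiv R (u @ v) (u @ r @ v)"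

definition finitely_presented :: "('a, 'b) monoid_scheme \<Rightarrow> bool" where
  "finitely_presented G \<longleftrightarrow>
     (\<exists>S R. finite S \<and> S \<subseteq> carrier G \<and> generate G S = carrier G \<and>
        finite R \<and> R \<subseteq> words_over S \<and>
        (\<forall>r\<in>R. word_val G r = \<one>\<^bsub>G\<^esub>) \<and>
        (\<forall>ws\<in>words_over S. word_val G ws = \<one>\<^bsub>G\<^esub> \<longrightarrow> pres_equiv R ws []))"

definition free_basis :: "('a, 'b) monoid_scheme \<Rightarrow> 'a set \<Rightarrow> bool" where
  "free_basis G B \<longleftrightarrow> B \<subseteq> carrier G \<and> generate G B = carrier G \<and>
     (\<forall>ws\<in>words_over B. ws \<noteq> [] \<and> reduced_word ws \<longrightarrow> word_val G ws \<noteq> \<one>\<^bsub>G\<^esub>)"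

definition nonabelian_free_group :: "('a, 'b) monoid_scheme \<Rightarrow> bool" where
  "nonabelian_free_group G \<longleftrightarrow> group G \<and>
     (\<exists>B. free_basis G B \<and> (\<exists>x\<in>B. \<exists>y\<in>B. x \<noteq> y))"

text \<open>G is large: some finite-index subgroup H admits an epimorphism onto a
  non-abelian free group; equivalently (first isomorphism theorem) some
  quotient of H by a normal subgroup is a non-abelian free group.\<close>
definition large :: "('a, 'b) monoid_scheme \<Rightarrow> bool" where
  "large G \<longleftrightarrow>
     (\<exists>H. subgroup H G \<and> finite (rcosets\<^bsub>G\<^esub> H) \<and>
        (\<exists>N. N \<lhd> (G\<lparr>carrier := H\<rparr>) \<and>
             nonabelian_free_group ((G\<lparr>carrier := H\<rparr>) Mod N)))"

end

theory Submission
  imports Defs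
begin

text \<open>Let \<open>L = C\<^sub>2 * V\<^sub>4\<close> be generated by \<open>a\<close> and \<open>V\<^sub>4 = {1, b, c, d}\<close>. Stopping the recursion for \<open>G\<^sub>\<omega>\<close> at depth \<open>n\<close>
  and letting the letters act at the leaves through \<open>L\<close> gives a group \<open>G\<^sub>n\<close> mapping onto \<open>G\<^sub>\<omega>\<close>.
  Since taking sections shortens words, every word trivial in \<open>G\<^sub>\<omega>\<close> is trivial in \<open>G\<^sub>n\<close> for large \<open>n\<close>; as
  finitely many relators suffice for \<open>\<Gamma>\<close>, the epimorphism \<open>\<Gamma> \<rightarrow> G\<^sub>\<omega>\<close> lifts to an epimorphism \<open>\<Gamma> \<rightarrow> G\<^sub>n\<close>.
  The stabilizer in \<open>G\<^sub>n\<close> of the vertex \<open>1\<^sup>n\<close> has finite index, and taking sections there maps it onto \<open>L\<close>.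
  Finally the kernel of \<open>L \<rightarrow> V\<^sub>4 \<times> C\<^sub>2\<close> is free on the commutators \<open>[a, v]\<close>, \<open>v \<in> {b, c, d}\<close>.\<close>

section \<open>The Klein four-group and its characters\<close>

type_synonym klein = "bool \<times> bool"

definition kadd :: "klein \<Rightarrow> klein \<Rightarrow> klein" where
  "kadd u v = (fst u \<noteq> fst v, snd u \<noteq> snd v)"

abbreviation kzero :: klein where
  "kzero \<equiv> (False, False)"

lemma kadd_simps [simp]:
  "kadd kzero v = v" "kadd v kzero = v" "kadd v v = kzero" "kadd v (kadd v u) = u"
  "kadd u v = kzero \<longleftrightarrow> u = v"
  by (auto simp: kadd_def prod_eq_iff)

lemma kadd_assoc: "kadd (kadd u v) t = kadd u (kadd v t)"
  by (auto simp: kadd_def)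

lemma inj_kadd: "inj (kadd u)"
  by (rule inj_on_inverseI[where g = "kadd u"]) simp

lemma kadd_comp [simp]: "kadd u \<circ> kadd v = kadd (kadd u v)"
  by (auto simp: kadd_assoc)

lemma kadd_kzero_eq_id [simp]: "kadd kzero = id"
  by auto

text \<open>With \<open>b = (True, False)\<close>, \<open>c = (False, True)\<close>, \<open>d = (True, True)\<close>, the homomorphism \<open>chi i\<close>
  says which of \<open>b, c, d\<close> have first section \<open>a\<close> when \<open>\<omega>\<^sub>1 = i\<close>.\<close>
definition chi :: "nat \<Rightarrow> klein \<Rightarrow> bool" where
  "chi i v \<longleftrightarrow> (if i = 0 then fst v \<noteq> snd v else if i = 1 then fst v else i = 2 \<and> snd v)"

lemma chi_kadd: "chi i (kadd u v) \<longleftrightarrow> chi i u \<noteq> chi i v"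
  by (auto simp: chi_def kadd_def)

lemma chi_kzero [simp]: "\<not> chi i kzero"
  by (simp add: chi_def)

lemma ex_chi: "i \<le> 2 \<Longrightarrow> \<exists>v. chi i v"
  by (rule exI[of _ "if i = 2 then (False, True) else (True, False)"]) (auto simp: chi_def)

section \<open>Words in involutive letters and their actions\<close>

datatype letter = A | V klein

lemma finite_UNIV_letter: "finite (UNIV :: letter set)"
proof -
  have "UNIV = insert A (range V)"
    using letter.exhaust by auto
  then show ?thesis
    by (metis finite.insertI finite finite_imageI)
qed

primrec word_act :: "(letter \<Rightarrow> 'x \<Rightarrow> 'x) \<Rightarrow> letter list \<Rightarrow> 'x \<Rightarrow> 'x" where
  "word_act f [] = id"
| "word_act f (l # z) = f l \<circ> word_act f z"

lemma word_act_append [simp]: "word_act f (y @ z) = word_act f y \<circ> word_act f z"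
  by (induction y) (auto simp: comp_assoc)

text \<open>All letters act as involutions, so reversal plays the role of inversion of
  words.\<close>

lemma word_act_rev:
  assumes "\<And>l. f l \<circ> f l = id"
  shows "word_act f (rev z) \<circ> word_act f z = id"
proof (induction z)
  case (Cons l z)
  have "f l (f l x) = x" for x
    using assms by (metis comp_apply id_apply)
  with Cons show ?case
    by (auto simp: fun_eq_iff)
qed simp

lemma word_act_rev':
  assumes "\<And>l. f l \<circ> f l = id"
  shows "word_act f z \<circ> word_act f (rev z) = id"
  using word_act_rev[of f "rev z"] assms by simp

lemma inverse_comp_unique:
  assumes "f \<circ> p = id" "p \<circ> q = id"
  shows "f = q"
  by (metis assms comp_assoc comp_id id_comp)

section \<open>The letters as automorphisms of the binary tree\<close>

primrec tree_letter :: "(nat \<Rightarrow> nat) \<Rightarrow> letter \<Rightarrow> bool list \<Rightarrow> bool list" where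
  "tree_letter w A = tree_a"
| "tree_letter w (V v) = tree_gen (\<lambda>i. chi i v) w"

lemma tree_letter_generators:
  "tree_b w = tree_letter w (V (True, False))"
  "tree_c w = tree_letter w (V (False, True))"
  "tree_d w = tree_letter w (V (True, True))"
proof -
  have "(\<lambda>i. i = 0 \<or> i = 1) = (\<lambda>i. chi i (True, False))"
    "(\<lambda>i. i = 0 \<or> i = 2) = (\<lambda>i. chi i (False, True))"
    "(\<lambda>i. i = 1 \<or> i = 2) = (\<lambda>i. chi i (True, True))"
    by (auto simp: chi_def fun_eq_iff)
  then show "tree_b w = tree_letter w (V (True, False))"
    "tree_c w = tree_letter w (V (False, True))"
    "tree_d w = tree_letter w (V (True, True))"
    unfolding tree_b_def tree_c_def tree_d_def by simp_all
qed

lemma tree_a_tree_a [simp]: "tree_a (tree_a u) = u"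
  by (cases u) auto

lemma tree_gen_False: "tree_gen (\<lambda>i. False) w u = u"
  by (induction "\<lambda>i::nat. False" w u rule: tree_gen.induct) auto

lemma tree_gen_tree_gen: "tree_gen P w (tree_gen Q w u) = tree_gen (\<lambda>i. P i \<noteq> Q i) w u"
  by (induction Q w u rule: tree_gen.induct) auto

text \<open>This rests on the additivity of each \<open>chi i\<close>. Keeping
  \<open>V kzero\<close> as a letter makes the \<open>V\<close> letters closed under
  products.\<close>

lemma tree_letter_kadd: "tree_letter w (V u) \<circ> tree_letter w (V v) = tree_letter w (V (kadd u v))"
  by (auto simp: tree_gen_tree_gen chi_kadd)

lemma tree_letter_kzero: "tree_letter w (V kzero) = id"
  by (auto simp: tree_gen_False)

lemma tree_letter_involution: "tree_letter w l \<circ> tree_letter w l = id"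
  by (cases l) (auto simp: tree_letter_kadd tree_letter_kzero simp del: tree_letter.simps(2))

lemma shift_Omega_plus:
  assumes "w \<in> Omega_plus"
  shows "shift w \<in> Omega_plus"
proof -
  have "\<exists>n\<ge>N. shift w n \<noteq> c" for N c
  proof -
    have "\<exists>n\<ge>Suc N. w n \<noteq> c"
      using assms by (auto simp: Omega_plus_def)
    then obtain n where "n \<ge> Suc N" "w n \<noteq> c" by blast
    then show ?thesis
      by (intro exI[of _ "n - 1"]) (auto simp: shift_def)
  qed
  then show ?thesis
    using assms by (auto simp: Omega_plus_def Omega_def shift_def)
qed

text \<open>After the \<open>n\<close> leading letters \<open>True\<close> the parameter is
  \<open>w\<close> shifted \<open>n\<close> times, so the next \<open>False\<close> activates the
  section \<open>tree_a\<close>, which flips the last letter.\<close>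

lemma tree_gen_nontrivial:
  assumes "P (w n)"
  shows "tree_gen P w (replicate n True @ [False, False]) \<noteq> replicate n True @ [False, False]"
  using assms by (induction n arbitrary: w) (auto simp: shift_def)

text \<open>A nonzero \<open>v\<close> is killed by only one of \<open>chi 0\<close>,
  \<open>chi 1\<close>, \<open>chi 2\<close>. As \<open>w\<close> is not constant, some
  \<open>chi (w n) v\<close> holds, and then an explicit tree word is moved.\<close>

lemma tree_letter_eq_id:
  assumes "w \<in> Omega_plus" "tree_letter w l = id"
  shows "l = V kzero"
proof (cases l)
  case A
  then show ?thesis
    using fun_cong[OF assms(2), of "[True]"] by simp
next
  case (V v)
  show ?thesis
  proof (rule ccontr)
    assume "l \<noteq> V kzero"
    then have "v \<noteq> kzero" using V by simp
    then have "\<exists>i. \<forall>j\<le>2. \<not> chi j v \<longrightarrow> j = i"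
      by (cases v; cases "fst v"; cases "snd v")
        (auto simp: chi_def intro: exI[of _ "0::nat"] exI[of _ "1::nat"] exI[of _ "2::nat"])
    then obtain i where i: "\<And>j. j \<le> 2 \<Longrightarrow> \<not> chi j v \<Longrightarrow> j = i" by blast
    obtain n where n: "w n \<noteq> i"
      using assms by (auto simp: Omega_plus_def)
    have "w n \<le> 2"
      using assms by (auto simp: Omega_plus_def Omega_def)
    with i n have "chi (w n) v" by blast
    from tree_gen_nontrivial[of "\<lambda>i. chi i v" w n, OF this] show False
      using assms(2) V by simp
  qed
qed

section \<open>The action on leaves and the recursion truncated at finite depth\<close>

text \<open>Multiplication by a generator on the reduced words of a free product of groups of order two,
  extended by the identity to non-reduced words so as to be an involution of all lists.\<close>
definition toggle :: "klein list \<Rightarrow> klein list" where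
  "toggle s = (if distinct_adj (kzero # s) then kzero # s else if distinct_adj s then tl s else s)"

lemma toggle_toggle [simp]: "toggle (toggle s) = s"
  by (cases s) (auto simp: toggle_def distinct_adj_Cons)

text \<open>The group \<open>C\<^sub>2 * V\<^sub>4\<close> is the semidirect product of \<open>C\<^sub>2 * C\<^sub>2 * C\<^sub>2 * C\<^sub>2\<close> (indexed by \<open>V\<^sub>4\<close>) with \<open>V\<^sub>4\<close>,
  hence acts on the reduced words over \<open>V\<^sub>4\<close>: this is the first component of a leaf. The other two
  record the image in \<open>V\<^sub>4 \<times> C\<^sub>2\<close>.\<close>
type_synonym leaf = "klein list \<times> klein \<times> bool"

fun leaf_act :: "letter \<Rightarrow> leaf \<Rightarrow> leaf" where
  "leaf_act A (s, v, e) = (toggle s, v, \<not> e)"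
| "leaf_act (V u) (s, v, e) = (map (kadd u) s, kadd u v, e)"

text \<open>The recursion defining \<open>G\<^sub>\<omega>\<close> is followed down to depth \<open>n\<close> only; from there on the letters act on
  a leaf.\<close>
fun act :: "nat \<Rightarrow> (nat \<Rightarrow> nat) \<Rightarrow> letter \<Rightarrow> bool list \<times> leaf \<Rightarrow> bool list \<times> leaf" where
  "act 0 w l (u, y) = (u, leaf_act l y)"
| "act (Suc n) w l ([], y) = ([], y)"
| "act (Suc n) w A (x # u, y) = ((\<not> x) # u, y)"
| "act (Suc n) w (V v) (True # u, y) = apfst (Cons True) (act n (shift w) (V v) (u, y))"
| "act (Suc n) w (V v) (False # u, y) =
     apfst (Cons False) (if chi (w 0) v then act n (shift w) A (u, y) else (u, y))"

lemma act_A_A: "act n w A (act n w A p) = p"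
  by (cases p; cases n; cases "fst p"; cases "snd p") auto

lemma act_kadd: "act n w (V u) (act n w (V v) p) = act n w (V (kadd u v)) p"
proof (induction n arbitrary: w p)
  case 0
  then show ?case
    by (cases p; cases "snd p") (auto simp: kadd_assoc)
next
  case (Suc n)
  obtain q y where p: "p = (q, y)" by (cases p)
  have aux: "apfst (Cons x) r = (x # fst r, snd r)" for x and r :: "bool list \<times> leaf"
    by (cases r) auto
  show ?case
  proof (cases q)
    case (Cons x u)
    then show ?thesis
      by (cases x) (use Suc.IH[of "shift w" "(u, y)"] in
          \<open>auto simp: p aux chi_kadd act_A_A\<close>)
  qed (simp add: p)
qed

lemma act_kzero: "act n w (V kzero) p = p"
proof (induction n arbitrary: w p)
  case 0
  then show ?case
    by (cases p; cases "snd p") auto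
next
  case (Suc n)
  obtain q y where p: "p = (q, y)" by (cases p)
  show ?case
  proof (cases q)
    case (Cons x u)
    then show ?thesis
      by (cases x) (auto simp: p Suc)
  qed (simp add: p)
qed

lemma act_involution: "act n w l \<circ> act n w l = id"
  by (cases l) (auto simp: act_A_A act_kadd act_kzero)

section \<open>Sections of words at the first level\<close>

primrec swap_letter :: "letter \<Rightarrow> bool \<Rightarrow> bool" where
  "swap_letter A x = (\<not> x)"
| "swap_letter (V v) x = x"

text \<open>A section comes as a word of length at most one, empty where the section is trivial;
  this makes word length usable as an induction measure.\<close>

fun section_letter :: "nat \<Rightarrow> letter \<Rightarrow> bool \<Rightarrow> letter list" where
  "section_letter i A x = []"
| "section_letter i (V v) True = [V v]"
| "section_letter i (V v) False = (if chi i v then [A] else [])"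

primrec section_word :: "nat \<Rightarrow> letter list \<Rightarrow> bool \<Rightarrow> letter list" where
  "section_word i [] x = []"
| "section_word i (l # z) x =
     section_letter i l (word_act swap_letter z x) @ section_word i z x"

lemma tree_section:
  "word_act (tree_letter w) z (x # u) =
     word_act swap_letter z x # word_act (tree_letter (shift w)) (section_word (w 0) z x) u"
proof (induction z)
  case (Cons l z)
  then show ?case
    by (cases l; cases "word_act swap_letter z x") auto
qed simp

text \<open>The section words are those of the tree action, and only the depth drops by one. This
  common recursion carries relations of \<open>G_omega w\<close> over to the truncated
  actions.\<close>

lemma act_section:
  "word_act (act (Suc n) w) z (x # u, y) =
     apfst (Cons (word_act swap_letter z x))
       (word_act (act n (shift w)) (section_word (w 0) z x) (u, y))"
proof (induction z)
  case (Cons l z)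
  obtain q t where "word_act (act n (shift w)) (section_word (w 0) z x) (u, y) = (q, t)"
    by (rule prod.exhaust)
  with Cons show ?case
    by (cases l; cases "word_act swap_letter z x") auto
qed simp

lemma act_word_Nil: "word_act (act (Suc n) w) z ([], y) = ([], y)"
  by (induction z) auto

lemma length_section_letter: "length (section_letter i l x) \<le> 1"
  by (cases l; cases x) auto

lemma length_section_word: "length (section_word i z x) \<le> length z"
proof (induction z)
  case (Cons l z)
  then show ?case
    using length_section_letter[of i l "word_act swap_letter z x"] by simp
qed simp

lemma length_section_word_less: "A \<in> set z \<Longrightarrow> length (section_word i z x) < length z"
proof (induction z)
  case (Cons l z)
  then show ?case
    using length_section_letter[of i l "word_act swap_letter z x"] length_section_word[of i z x]
    by (cases "l = A") auto
qed simp

text \<open>The letters multiply in the Klein group. One \<open>v\<close> serves the tree action and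
  all truncated ones, so \<open>v = kzero\<close> found on the tree makes the word trivial at every
  depth.\<close>

lemma word_without_A:
  assumes "A \<notin> set z"
  obtains v where "\<And>w. word_act (tree_letter w) z = tree_letter w (V v)"
    "\<And>n w. word_act (act n w) z = act n w (V v)"
  using assms
proof (induction z arbitrary: thesis)
  case Nil
  show ?case
    by (rule Nil.prems(1)[of kzero])
      (auto simp: tree_letter_kzero act_kzero simp del: tree_letter.simps(2))
next
  case (Cons l z)
  obtain u where l: "l = V u"
    using Cons.prems(2) by (cases l) auto
  from Cons obtain v where "\<And>w. word_act (tree_letter w) z = tree_letter w (V v)"
    "\<And>n w. word_act (act n w) z = act n w (V v)"
    by auto
  with l show ?case
    by (intro Cons.prems(1)[of "kadd u v"])
      (auto simp: tree_letter_kadd act_kadd simp del: tree_letter.simps(2))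
qed

text \<open>A letter \<open>A\<close> contributes nothing to the first-level sections, so these are shorter than the word;
  a word without \<open>A\<close> amounts to a single letter \<open>V v\<close>, and \<open>\<omega> \<in> \<Omega>\<^sub>+\<close> forces \<open>v = 0\<close> if it is trivial.\<close>
lemma trivial_word_eventually_trivial:
  assumes "w \<in> Omega_plus" "word_act (tree_letter w) z = id"
  shows "\<forall>\<^sub>F n in sequentially. word_act (act n w) z = id"
  using assms
proof (induction "length z" arbitrary: z w rule: less_induct)
  case less
  show ?case
  proof (cases "A \<in> set z")
    case False
    then obtain v where v: "\<And>w. word_act (tree_letter w) z = tree_letter w (V v)"
      "\<And>n w. word_act (act n w) z = act n w (V v)"
      by (rule word_without_A) blast
    with less.prems tree_letter_eq_id[of w "V v"] have "v = kzero" by simp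
    with v show ?thesis
      by (auto simp: act_kzero fun_eq_iff)
  next
    case True
    \<comment> \<open>One-letter tree words show that the first level is fixed; longer ones then
      show that both sections are trivial.\<close>
    have swap: "word_act swap_letter z x = x" for x
      using tree_section[of w z x "[]"] less.prems by simp
    have "word_act (tree_letter (shift w)) (section_word (w 0) z x) = id" for x
      using tree_section[of w z x] less.prems by (auto simp: fun_eq_iff)
    with less True have "\<forall>\<^sub>F n in sequentially. word_act (act n (shift w)) (section_word (w 0) z x) = id" for x
      using length_section_word_less shift_Omega_plus by blast
    then have "\<forall>\<^sub>F n in sequentially. \<forall>x. word_act (act n (shift w)) (section_word (w 0) z x) = id"
      by (simp add: eventually_all_finite)
    then have "\<forall>\<^sub>F n in sequentially. word_act (act (Suc n) w) z = id"
    proof eventually_elim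
      case (elim n)
      have "word_act (act (Suc n) w) z (u, y) = (u, y)" for u y
        by (cases u) (use elim in \<open>simp_all add: act_word_Nil act_section swap\<close>)
      then show ?case
        by auto
    qed
    then show ?thesis
      by (rule iffD1[OF eventually_sequentially_Suc[of "\<lambda>n. word_act (act n w) z = id"]])
  qed
qed

subsection \<open>Words in a group and finite presentations\<close>

lemma (in group) letter_val_closed:
  "fst l \<in> carrier G \<Longrightarrow> letter_val G l \<in> carrier G"
  by (simp add: letter_val_def)

lemma word_val_simps [simp]:
  "word_val G [] = \<one>\<^bsub>G\<^esub>"
  "word_val G (l # ws) = letter_val G l \<otimes>\<^bsub>G\<^esub> word_val G ws"
  by (simp_all add: word_val_def)

lemma words_over_simps [simp]:
  "[] \<in> words_over S"
  "l # ws \<in> words_over S \<longleftrightarrow> fst l \<in> S \<and> ws \<in> words_over S"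
  "us @ ws \<in> words_over S \<longleftrightarrow> us \<in> words_over S \<and> ws \<in> words_over S"
  by (cases l; auto simp: words_over_def)+

lemma (in group) word_val_closed:
  assumes "S \<subseteq> carrier G" "ws \<in> words_over S"
  shows "word_val G ws \<in> carrier G"
  using assms(2) by (induction ws) (use assms(1) letter_val_closed in auto)

lemma (in group) word_val_append:
  assumes "S \<subseteq> carrier G" "us \<in> words_over S" "ws \<in> words_over S"
  shows "word_val G (us @ ws) = word_val G us \<otimes> word_val G ws"
  using assms(2)
proof (induction us)
  case Nil
  then show ?case using word_val_closed assms by simp
next
  case (Cons l us)
  then have "letter_val G l \<in> carrier G"
    using assms(1) by (intro letter_val_closed) auto
  with Cons show ?case
    using word_val_closed assms by (auto simp: m_assoc)
qed

definition word_inv :: "('a \<times> bool) list \<Rightarrow> ('a \<times> bool) list" where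
  "word_inv ws = map letter_inv (rev ws)"

lemma word_inv_words_over: "ws \<in> words_over S \<Longrightarrow> word_inv ws \<in> words_over S"
  by (auto simp: words_over_def word_inv_def letter_inv_def)

lemma (in group) word_val_word_inv:
  assumes "S \<subseteq> carrier G" "ws \<in> words_over S"
  shows "word_val G (word_inv ws) = inv (word_val G ws)"
  using assms(2)
proof (induction ws)
  case Nil
  then show ?case by (simp add: word_inv_def)
next
  case (Cons l ws)
  have l: "fst l \<in> carrier G"
    using Cons.prems assms(1) by auto
  have "word_val G (word_inv (l # ws)) = word_val G (word_inv ws @ [letter_inv l])"
    by (simp add: word_inv_def)
  also have "\<dots> = word_val G (word_inv ws) \<otimes> word_val G [letter_inv l]"
    using Cons.prems word_inv_words_over
    by (intro word_val_append[OF assms(1)]) (auto simp: letter_inv_def)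
  also have "word_val G [letter_inv l] = inv (letter_val G l)"
    using l by (auto simp: letter_inv_def letter_val_def)
  also have "word_val G (word_inv ws) \<otimes> inv (letter_val G l) = inv (word_val G (l # ws))"
    using Cons l letter_val_closed word_val_closed[OF assms(1)]
    by (simp add: inv_mult_group)
  finally show ?case .
qed

lemma (in group) generate_word_val:
  assumes "S \<subseteq> carrier G" "g \<in> generate G S"
  shows "\<exists>ws\<in>words_over S. word_val G ws = g"
  using assms(2)
proof induction
  case one
  then show ?case by (intro bexI[of _ "[]"]) auto
next
  case (incl h)
  then show ?case
    using assms(1) by (intro bexI[of _ "[(h, False)]"]) (auto simp: letter_val_def)
next
  case (inv h)
  then show ?case
    using assms(1) by (intro bexI[of _ "[(h, True)]"]) (auto simp: letter_val_def)
next
  case (eng g h)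
  then show ?case
    using word_val_append[OF assms(1)] by (metis words_over_simps(3))
qed

text \<open>Formal inverses become reversed words because letters act as involutions.\<close>

definition lift_letter :: "('g \<Rightarrow> letter list) \<Rightarrow> 'g \<times> bool \<Rightarrow> letter list" where
  "lift_letter lam l = (if snd l then rev (lam (fst l)) else lam (fst l))"

definition lift_word :: "('g \<Rightarrow> letter list) \<Rightarrow> ('g \<times> bool) list \<Rightarrow> letter list" where
  "lift_word lam ws = concat (map (lift_letter lam) ws)"

lemma lift_word_simps [simp]:
  "lift_word lam [] = []"
  "lift_word lam (l # ws) = lift_letter lam l @ lift_word lam ws"
  "lift_word lam (us @ ws) = lift_word lam us @ lift_word lam ws"
  by (simp_all add: lift_word_def)

lemma lift_word_word_inv: "lift_word lam (word_inv ws) = rev (lift_word lam ws)"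
  by (induction ws) (auto simp: word_inv_def lift_letter_def letter_inv_def)

text \<open>Von Dyck's argument: a reversed word acts as the inverse, so cancelling pairs act
  trivially, and relators do so by assumption.\<close>

lemma word_act_pres_equiv:
  assumes "pres_equiv R us ws"
    and "\<And>l. f l \<circ> f l = id"
    and "\<And>r. r \<in> R \<Longrightarrow> word_act f (lift_word lam r) = id"
  shows "word_act f (lift_word lam us) = word_act f (lift_word lam ws)"
  using assms(1)
proof induction
  case (cancel u v l)
  have "word_act f (lift_letter lam l) \<circ> word_act f (lift_letter lam (letter_inv l)) = id"
    using word_act_rev[of f] word_act_rev'[of f] assms(2)
    by (auto simp: lift_letter_def letter_inv_def)
  then have "word_act f (lift_letter lam l) (word_act f (lift_letter lam (letter_inv l)) x) = x" for x
    by (metis comp_apply id_apply)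
  then show ?case
    by (simp add: fun_eq_iff)
qed (use assms(3) in auto)

text \<open>The image of the unit is an idempotent map, and it is invertible because it is the
  action of a word.\<close>

lemma word_action_one:
  assumes "group G" "\<And>l. f l \<circ> f l = id"
    and "\<And>g h. g \<in> carrier G \<Longrightarrow> h \<in> carrier G \<Longrightarrow> \<theta> (g \<otimes>\<^bsub>G\<^esub> h) = \<theta> g \<circ> \<theta> h"
    and "\<And>g. g \<in> carrier G \<Longrightarrow> \<exists>z. \<theta> g = word_act f z"
  shows "\<theta> \<one>\<^bsub>G\<^esub> = id"
proof -
  interpret group G by fact
  obtain z where z: "\<theta> \<one>\<^bsub>G\<^esub> = word_act f z"
    using assms(4) by auto
  have "\<theta> \<one>\<^bsub>G\<^esub> = \<theta> \<one>\<^bsub>G\<^esub> \<circ> \<theta> \<one>\<^bsub>G\<^esub>"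
    using assms(3)[of "\<one>\<^bsub>G\<^esub>" "\<one>\<^bsub>G\<^esub>"] by simp
  then have "word_act f (rev z) \<circ> word_act f z = word_act f (rev z) \<circ> (word_act f z \<circ> word_act f z)"
    using z by simp
  then show ?thesis
    using z word_act_rev[of f z] assms(2) by (simp flip: comp_assoc)
qed

text \<open>Two finite families of words must become trivial at a common depth: the lifted relators,
  which makes \<open>\<theta>\<close> well defined, and one word per letter, which puts every letter
  in its image.\<close>

lemma finitely_presented_acts:
  fixes \<Gamma> :: "('g, 'c) monoid_scheme"
  assumes w: "w \<in> Omega_plus" and "group \<Gamma>" and fp: "finitely_presented \<Gamma>"
    and mult: "\<And>g h. g \<in> carrier \<Gamma> \<Longrightarrow> h \<in> carrier \<Gamma> \<Longrightarrow> \<phi> (g \<otimes>\<^bsub>\<Gamma>\<^esub> h) = \<phi> g \<circ> \<phi> h"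
    and word: "\<And>g. g \<in> carrier \<Gamma> \<Longrightarrow> \<exists>z. \<phi> g = word_act (tree_letter w) z"
    and onto: "\<And>l. \<exists>g\<in>carrier \<Gamma>. \<phi> g = tree_letter w l"
  shows "\<exists>n \<theta>. (\<forall>g\<in>carrier \<Gamma>. \<forall>h\<in>carrier \<Gamma>. \<theta> (g \<otimes>\<^bsub>\<Gamma>\<^esub> h) = \<theta> g \<circ> \<theta> h) \<and>
    (\<forall>g\<in>carrier \<Gamma>. \<exists>z. \<theta> g = word_act (act n w) z) \<and>
    (\<forall>l. \<exists>g\<in>carrier \<Gamma>. \<theta> g = act n w l)"
proof -
  interpret group \<Gamma> by fact
  obtain S R where S: "finite S" "S \<subseteq> carrier \<Gamma>" "generate \<Gamma> S = carrier \<Gamma>"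
    and R: "finite R" "R \<subseteq> words_over S" "\<And>r. r \<in> R \<Longrightarrow> word_val \<Gamma> r = \<one>\<^bsub>\<Gamma>\<^esub>"
    and pres: "\<And>ws. ws \<in> words_over S \<Longrightarrow> word_val \<Gamma> ws = \<one>\<^bsub>\<Gamma>\<^esub> \<Longrightarrow> pres_equiv R ws []"
    using fp unfolding finitely_presented_def by blast
  have one: "\<phi> \<one>\<^bsub>\<Gamma>\<^esub> = id"
    using word_action_one[of \<Gamma> "tree_letter w" \<phi>] mult word tree_letter_involution is_group by blast
  define lam where "lam g = (SOME z. \<phi> g = word_act (tree_letter w) z)" for g
  have lam: "\<phi> g = word_act (tree_letter w) (lam g)" if "g \<in> carrier \<Gamma>" for g
    unfolding lam_def using word[OF that] by (rule someI_ex)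
  have lam_inv: "\<phi> (inv\<^bsub>\<Gamma>\<^esub> g) = word_act (tree_letter w) (rev (lam g))" if g: "g \<in> carrier \<Gamma>" for g
  proof (rule inverse_comp_unique)
    show "\<phi> (inv\<^bsub>\<Gamma>\<^esub> g) \<circ> \<phi> g = id"
      using mult[of "inv\<^bsub>\<Gamma>\<^esub> g" g] g one by simp
    show "\<phi> g \<circ> word_act (tree_letter w) (rev (lam g)) = id"
      using lam[OF g] word_act_rev'[of "tree_letter w"] tree_letter_involution by simp
  qed
  have val: "\<phi> (word_val \<Gamma> ws) = word_act (tree_letter w) (lift_word lam ws)"
    if "ws \<in> words_over S" for ws
    using that
  proof (induction ws)
    case Nil
    then show ?case by (simp add: one)
  next
    case (Cons l ws)
    then have "fst l \<in> carrier \<Gamma>" using S(2) by auto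
    moreover from this have "\<phi> (letter_val \<Gamma> l) = word_act (tree_letter w) (lift_letter lam l)"
      using lam lam_inv by (simp add: letter_val_def lift_letter_def)
    ultimately show ?case
      using Cons mult letter_val_closed word_val_closed[OF S(2)] by auto
  qed
  have ex_ws: "\<exists>ws\<in>words_over S. word_val \<Gamma> ws = g" if "g \<in> carrier \<Gamma>" for g
    using generate_word_val[OF S(2)] S(3) that by blast
  have "\<exists>ws\<in>words_over S. \<phi> (word_val \<Gamma> ws) = tree_letter w l" for l
    using onto[of l] ex_ws by metis
  then obtain gw where gw: "\<And>l. gw l \<in> words_over S" "\<And>l. \<phi> (word_val \<Gamma> (gw l)) = tree_letter w l"
    by metis
  have "\<forall>\<^sub>F n in sequentially. word_act (act n w) (lift_word lam r) = id" if "r \<in> R" for r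
  proof (rule trivial_word_eventually_trivial[OF w])
    show "word_act (tree_letter w) (lift_word lam r) = id"
      using val[of r] R(2) R(3)[OF that] that one by auto
  qed
  then have ev1: "\<forall>\<^sub>F n in sequentially. \<forall>r\<in>R. word_act (act n w) (lift_word lam r) = id"
    using R(1) by (simp add: eventually_ball_finite)
  \<comment> \<open>As \<open>l\<close> acts as an involution, triviality of this word at depth
    \<open>n\<close> says that the lift of \<open>gw l\<close> acts there as
    \<open>l\<close>.\<close>
  have "\<forall>\<^sub>F n in sequentially. word_act (act n w) (lift_word lam (gw l) @ [l]) = id" for l
  proof (rule trivial_word_eventually_trivial[OF w])
    show "word_act (tree_letter w) (lift_word lam (gw l) @ [l]) = id"
      using val[OF gw(1)[of l]] gw(2)[of l] tree_letter_involution[of w l] by simp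
  qed
  then have "\<forall>\<^sub>F n in sequentially. \<forall>l\<in>UNIV. word_act (act n w) (lift_word lam (gw l) @ [l]) = id"
    by (intro eventually_ball_finite finite_UNIV_letter) auto
  from eventually_happens'[OF sequentially_bot eventually_conj[OF ev1 this]]
  obtain n where nR: "\<And>r. r \<in> R \<Longrightarrow> word_act (act n w) (lift_word lam r) = id"
    and nl: "\<And>l. word_act (act n w) (lift_word lam (gw l) @ [l]) = id"
    by blast
  let ?f = "act n w"
  \<comment> \<open>Words with equal value in \<open>\<Gamma>\<close> differ by a consequence of the
    relators, so the truncated action depends on the group element alone.\<close>
  have wd: "word_act ?f (lift_word lam us) = word_act ?f (lift_word lam ws)"
    if "us \<in> words_over S" "ws \<in> words_over S" "word_val \<Gamma> us = word_val \<Gamma> ws" for us ws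
  proof (rule inverse_comp_unique)
    have "word_val \<Gamma> (us @ word_inv ws) = \<one>\<^bsub>\<Gamma>\<^esub>"
      using that S(2) word_val_closed[OF S(2)]
      by (simp add: word_val_append[OF S(2)] word_inv_words_over word_val_word_inv[OF S(2)])
    then have "pres_equiv R (us @ word_inv ws) []"
      using that by (intro pres) (auto simp: word_inv_words_over)
    from word_act_pres_equiv[OF this, of ?f lam]
    show "word_act ?f (lift_word lam us) \<circ> word_act ?f (rev (lift_word lam ws)) = id"
      using nR act_involution by (simp add: lift_word_word_inv)
    show "word_act ?f (rev (lift_word lam ws)) \<circ> word_act ?f (lift_word lam ws) = id"
      using word_act_rev[of ?f] act_involution by blast
  qed
  define ws where "ws g = (SOME us. us \<in> words_over S \<and> word_val \<Gamma> us = g)" for g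
  have ws: "ws g \<in> words_over S" "word_val \<Gamma> (ws g) = g" if "g \<in> carrier \<Gamma>" for g
    using someI_ex[OF ex_ws[OF that, unfolded Bex_def]] unfolding ws_def by auto
  show ?thesis
  proof (intro exI[of _ n] exI[of _ "\<lambda>g. word_act ?f (lift_word lam (ws g))"] conjI ballI allI)
    fix g h assume gh: "g \<in> carrier \<Gamma>" "h \<in> carrier \<Gamma>"
    then have "word_act ?f (lift_word lam (ws (g \<otimes>\<^bsub>\<Gamma>\<^esub> h))) = word_act ?f (lift_word lam (ws g @ ws h))"
      by (intro wd) (auto simp: ws word_val_append[OF S(2)])
    then show "word_act ?f (lift_word lam (ws (g \<otimes>\<^bsub>\<Gamma>\<^esub> h))) =
        word_act ?f (lift_word lam (ws g)) \<circ> word_act ?f (lift_word lam (ws h))"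
      by simp
  next
    fix l
    let ?g = "word_val \<Gamma> (gw l)"
    have g: "?g \<in> carrier \<Gamma>"
      using gw(1) word_val_closed[OF S(2)] by blast
    have "word_act ?f (lift_word lam (ws ?g)) = word_act ?f (lift_word lam (gw l))"
      using g gw(1) by (intro wd) (auto simp: ws)
    also have "\<dots> = ?f l"
    proof (rule inverse_comp_unique)
      show "word_act ?f (lift_word lam (gw l)) \<circ> ?f l = id"
        using nl[of l] by simp
    qed (rule act_involution)
    finally show "\<exists>g\<in>carrier \<Gamma>. word_act ?f (lift_word lam (ws g)) = ?f l"
      using g by blast
  qed blast
qed

subsection \<open>Free quotients\<close>

lemma hom_word_val:
  assumes "group F" "group G" "f \<in> hom F G" "B \<subseteq> carrier F" "ws \<in> words_over B"
  shows "word_val G (map (apfst f) ws) = f (word_val F ws)"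
proof -
  interpret group_hom F G f
    using assms by (simp add: group_hom_def group_hom_axioms_def)
  show ?thesis
    using assms(5)
  proof (induction ws)
    case (Cons l ws)
    then have l: "fst l \<in> carrier F" using assms(4) by auto
    then have "letter_val G (apfst f l) = f (letter_val F l)"
      by (cases l) (auto simp: letter_val_def)
    with Cons l show ?case
      using G.letter_val_closed G.word_val_closed[OF assms(4)] by auto
  qed simp
qed

text \<open>A cancelling pair of neighbours remains cancelling under any relabelling.\<close>

lemma reduced_word_map_apfst: "reduced_word (map (apfst f) ws) \<Longrightarrow> reduced_word ws"
proof (induction ws rule: reduced_word.induct)
  case (3 l m ws)
  then show ?case
    by (cases l; cases m) (auto simp: letter_inv_def)
qed auto

text \<open>A reduced word over the image of \<open>B\<close> pulls back letterwise to a reduced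
  word over \<open>B\<close>, and injectivity of \<open>f\<close> keeps its value
  nontrivial.\<close>

lemma nonabelian_free_group_iso:
  assumes "f \<in> iso F G" "group G" "nonabelian_free_group F"
  shows "nonabelian_free_group G"
proof -
  obtain B x y where F: "group F" and B: "B \<subseteq> carrier F" "generate F B = carrier F"
    and red: "\<And>ws. ws \<in> words_over B \<Longrightarrow> ws \<noteq> [] \<Longrightarrow> reduced_word ws \<Longrightarrow> word_val F ws \<noteq> \<one>\<^bsub>F\<^esub>"
    and xy: "x \<in> B" "y \<in> B" "x \<noteq> y"
    using assms(3) unfolding nonabelian_free_group_def free_basis_def by blast
  have f: "f \<in> hom F G" "inj_on f (carrier F)" "f ` carrier F = carrier G"
    using assms(1) by (auto simp: iso_def bij_betw_def)
  interpret group_hom F G f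
    using F assms(2) f by (simp add: group_hom_def group_hom_axioms_def)
  have "word_val G ws \<noteq> \<one>\<^bsub>G\<^esub>"
    if ws: "ws \<in> words_over (f ` B)" "ws \<noteq> []" "reduced_word ws" for ws
  proof -
    define us where "us = map (apfst (inv_into B f)) ws"
    have "map (apfst f) us = map (\<lambda>l. l) ws"
      unfolding us_def map_map
      by (rule map_cong) (use ws(1) in \<open>auto simp: words_over_def f_inv_into_f\<close>)
    then have ws_us: "ws = map (apfst f) us" by simp
    have us: "us \<in> words_over B"
      using ws(1) by (auto simp: us_def words_over_def inv_into_into)
    have "word_val F us \<noteq> \<one>\<^bsub>F\<^esub>"
      using red[OF us] ws ws_us reduced_word_map_apfst by auto
    moreover have "word_val F us \<in> carrier F"
      using G.word_val_closed B(1) us by blast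
    ultimately have "f (word_val F us) \<noteq> f \<one>\<^bsub>F\<^esub>"
      using f(2) by (meson G.one_closed inj_onD)
    then show ?thesis
      using hom_word_val[OF F assms(2) f(1) B(1) us] ws_us by simp
  qed
  moreover have "generate G (f ` B) = carrier G"
    using generate_img[OF B(1)] B(2) f(3) by simp
  moreover have "f x \<noteq> f y"
    using xy f(2) B(1) by (meson inj_onD subsetD)
  ultimately have "free_basis G (f ` B)" "f x \<noteq> f y"
    using B(1) f(3) unfolding free_basis_def by auto
  then show ?thesis
    using assms(2) xy unfolding nonabelian_free_group_def by blast
qed

lemma (in group) nonabelian_free_group_generate:
  assumes "B \<subseteq> carrier G" "x \<in> B" "y \<in> B" "x \<noteq> y"
    and "\<And>ws. ws \<in> words_over B \<Longrightarrow> ws \<noteq> [] \<Longrightarrow> reduced_word ws \<Longrightarrow> word_val G ws \<noteq> \<one>"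
  shows "nonabelian_free_group (G\<lparr>carrier := generate G B\<rparr>)"
proof -
  let ?F = "G\<lparr>carrier := generate G B\<rparr>"
  have sub: "subgroup (generate G B) G"
    using generate_is_subgroup assms(1) by blast
  have B: "B \<subseteq> generate G B"
    by (rule subsetI) (rule generate.incl)
  have "word_val ?F ws = word_val G ws" if "ws \<in> words_over B" for ws
    using that
  proof (induction ws)
    case (Cons l ws)
    then have "fst l \<in> generate G B" using B by auto
    then have "letter_val ?F l = letter_val G l"
      using m_inv_consistent[OF sub] by (simp add: letter_val_def)
    with Cons show ?case by simp
  qed simp
  then have "free_basis ?F B"
    using assms(5) generate_consistent[OF B sub] B by (simp add: free_basis_def)
  then show ?thesis
    using assms sub subgroup_imp_group unfolding nonabelian_free_group_def by blast
qed

text \<open>The image of \<open>h\<close> is free on \<open>B\<close>; the inverse of the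
  isomorphism from the first isomorphism theorem carries freeness over to the quotient by the
  kernel.\<close>

lemma nonabelian_free_quotient:
  assumes "group G" "group K" "h \<in> hom G K" "h ` carrier G = generate K B"
    and "B \<subseteq> carrier K" "x \<in> B" "y \<in> B" "x \<noteq> y"
    and "\<And>ws. ws \<in> words_over B \<Longrightarrow> ws \<noteq> [] \<Longrightarrow> reduced_word ws \<Longrightarrow> word_val K ws \<noteq> \<one>\<^bsub>K\<^esub>"
  shows "kernel G K h \<lhd> G \<and> nonabelian_free_group (G Mod (kernel G K h))"
proof -
  let ?F = "K\<lparr>carrier := generate K B\<rparr>"
  have free: "nonabelian_free_group ?F"
    using group.nonabelian_free_group_generate[OF assms(2,5-8)] assms(9) by blast
  then have "group ?F" unfolding nonabelian_free_group_def by blast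
  moreover have "h \<in> hom G ?F"
    using assms(3,4) by (auto simp: hom_def)
  ultimately interpret group_hom G ?F h
    using assms(1) by (simp add: group_hom_def group_hom_axioms_def)
  have ker: "kernel G ?F h = kernel G K h"
    by (simp add: kernel_def)
  have norm: "kernel G K h \<lhd> G"
    using normal_kernel ker by simp
  interpret Q: group "G Mod (kernel G K h)"
    using norm normal.factorgroup_is_group by blast
  have "(\<lambda>Y. the_elem (h ` Y)) \<in> iso (G Mod (kernel G K h)) ?F"
    using FactGroup_iso_set assms(4) ker by simp
  then have "inv_into (carrier (G Mod (kernel G K h))) (\<lambda>Y. the_elem (h ` Y))
      \<in> iso ?F (G Mod (kernel G K h))"
    by (rule Q.iso_set_sym)
  from nonabelian_free_group_iso[OF this Q.is_group free] norm show ?thesis by blast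
qed

subsection \<open>A free subgroup of finite index in the leaf action\<close>

text \<open>The conjugate of \<open>toggle\<close> by \<open>v\<close>: on reduced words, left
  multiplication by the generator of order two indexed by \<open>v\<close>.\<close>

definition hop :: "klein \<Rightarrow> klein list \<Rightarrow> klein list" where
  "hop v s = map (kadd v) (toggle (map (kadd v) s))"

lemma hop_hop [simp]: "hop v (hop v s) = s"
  by (simp add: hop_def)

lemma hop_kzero [simp]: "hop kzero = toggle"
  by (auto simp: hop_def)

lemma hop_eq_Cons:
  assumes "distinct_adj (v # s)"
  shows "hop v s = v # s"
proof -
  have "distinct_adj (map (kadd v) (v # s))"
    using assms by (intro distinct_adj_mapI inj_on_subset[OF inj_kadd]) auto
  then show ?thesis
    by (simp add: hop_def toggle_def)
qed

lemma hop_Cons: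
  assumes "distinct_adj (v # s)"
  shows "hop v (v # s) = s"
  using hop_eq_Cons[OF assms] hop_hop by metis

lemma map_kadd_toggle: "map (kadd v) (toggle s) = hop v (map (kadd v) s)"
  by (simp add: hop_def)

text \<open>The action of the commutator \<open>[a, v] = a v a v\<close> on the first component of a
  leaf, that is, of the product of the generators indexed by \<open>kzero\<close> and
  \<open>v\<close>.\<close>

definition shear :: "klein \<Rightarrow> klein list \<Rightarrow> klein list" where
  "shear v = toggle \<circ> hop v"

definition unshear :: "klein \<Rightarrow> klein list \<Rightarrow> klein list" where
  "unshear v = hop v \<circ> toggle"

text \<open>The value \<open>kzero\<close> is left out because its shear is the identity.\<close>

definition shears :: "(klein list \<Rightarrow> klein list) set" where
  "shears = shear ` (- {kzero})"

abbreviation listperms :: "(klein list \<Rightarrow> klein list) monoid" where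
  "listperms \<equiv> BijGroup UNIV"

lemma carrier_BijGroup_UNIV: "carrier (BijGroup UNIV) = {f. bij f}"
  by (auto simp: BijGroup_def Bij_def)

lemma mult_BijGroup_UNIV: "bij f \<Longrightarrow> bij g \<Longrightarrow> f \<otimes>\<^bsub>BijGroup UNIV\<^esub> g = f \<circ> g"
  by (auto simp: BijGroup_def Bij_def compose_def)

lemma one_BijGroup_UNIV: "\<one>\<^bsub>BijGroup UNIV\<^esub> = id"
  by (auto simp: BijGroup_def)

lemma bij_shear: "bij (shear v)" and bij_unshear: "bij (unshear v)"
  by (rule o_bij[of "unshear v"], auto simp: shear_def unshear_def)
    (rule o_bij[of "shear v"], auto simp: shear_def unshear_def)

lemma shears_carrier: "shears \<subseteq> carrier listperms"
  by (auto simp: shears_def carrier_BijGroup_UNIV bij_shear)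

lemma inv_shear: "inv\<^bsub>listperms\<^esub> (shear v) = unshear v"
proof (rule group.inv_equality[OF group_BijGroup])
  show "unshear v \<otimes>\<^bsub>listperms\<^esub> shear v = \<one>\<^bsub>listperms\<^esub>"
    unfolding mult_BijGroup_UNIV[OF bij_unshear bij_shear] one_BijGroup_UNIV
    by (auto simp: shear_def unshear_def)
qed (auto simp: carrier_BijGroup_UNIV bij_shear bij_unshear)

lemma letter_val_shear:
  "letter_val listperms (shear v, e) = (if e then unshear v else shear v)"
  by (simp add: letter_val_def inv_shear)

text \<open>Evaluation at the empty list records the leading letter of the word:
  \<open>shear v\<close> leaves \<open>kzero\<close> and \<open>v\<close> in front, its inverse
  leaves \<open>v\<close>. So the empty list is moved, which gives freeness.\<close>

lemma reduced_word_in_shears: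
  assumes "ws \<in> words_over shears" "reduced_word ws" "ws \<noteq> []"
  shows "distinct_adj (word_val listperms ws []) \<and>
    (\<exists>v e t. v \<noteq> kzero \<and> hd ws = (shear v, e) \<and>
       word_val listperms ws [] = (if e then v # t else kzero # v # t))"
  using assms
proof (induction ws)
  case (Cons l ws)
  interpret group listperms by (rule group_BijGroup)
  note IH = Cons.IH and prems = Cons.prems
  obtain v e where l: "l = (shear v, e)" and v: "v \<noteq> kzero"
    using Cons.prems(1) by (cases l) (auto simp: shears_def)
  have "bij (word_val listperms ws)"
    using word_val_closed[OF shears_carrier] Cons.prems(1) by (auto simp: carrier_BijGroup_UNIV)
  then have val: "word_val listperms ((shear v, e) # ws) [] =
      (if e then unshear v else shear v) (word_val listperms ws [])"
    by (simp add: letter_val_shear mult_BijGroup_UNIV bij_shear bij_unshear)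
  have thesisI: ?case
    if "(if e then unshear v else shear v) (word_val listperms ws []) =
        (if e then v # t else kzero # v # t)"
      and "distinct_adj (if e then v # t else kzero # v # t)" for t
    unfolding l val that(1)
    by (intro conjI exI[of _ v] exI[of _ e] exI[of _ t]) (use v that(2) in simp_all)
  show ?case
  proof (cases ws)
    case Nil
    have "shear v [] = [kzero, v]" "unshear v [] = [v, kzero]"
      using v hop_eq_Cons[of v "[]"] hop_eq_Cons[of kzero "[]"] hop_eq_Cons[of kzero "[v]"]
        hop_eq_Cons[of v "[kzero]"]
      by (auto simp: shear_def unshear_def)
    then show ?thesis
      using v by (intro thesisI[of "if e then [kzero] else []"]) (auto simp: Nil one_BijGroup_UNIV)
  next
    case (Cons m us)
    with prems have ws: "ws \<in> words_over shears" "reduced_word ws" "ws \<noteq> []" "hd ws = m"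
      and "m \<noteq> letter_inv l"
      by auto
    from IH[OF ws(1-3)] obtain u d t where u: "u \<noteq> kzero" "m = (shear u, d)"
      and s: "word_val listperms ws [] = (if d then u # t else kzero # u # t)"
      and dist: "distinct_adj (word_val listperms ws [])"
      unfolding ws(4) by blast
    show ?thesis
    proof (cases e)
      case False
      \<comment> \<open>If the list starts with \<open>u\<close>, then \<open>u\<close> differs from
        \<open>v\<close>, since otherwise \<open>m\<close> would be inverse to \<open>l\<close>; if
        it starts with \<open>kzero\<close>, then \<open>v\<close> is nonzero.\<close>
      have "distinct_adj (kzero # v # word_val listperms ws [])"
        using dist s v u l False \<open>m \<noteq> letter_inv l\<close>
        by (auto simp: distinct_adj_Cons letter_inv_def split: if_splits)
      moreover from this have "shear v (word_val listperms ws []) = kzero # v # word_val listperms ws []"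
        using hop_eq_Cons[of v "word_val listperms ws []"]
          hop_eq_Cons[of kzero "v # word_val listperms ws []"]
        by (simp add: shear_def)
      ultimately show ?thesis
        using False by (intro thesisI[of "word_val listperms ws []"]) simp_all
    next
      case True
      show ?thesis
      proof (cases d)
        case d: True
        have "distinct_adj (v # kzero # u # t)"
          using dist s v u d by (auto simp: distinct_adj_Cons)
        moreover from this have "unshear v (u # t) = v # kzero # u # t"
          using hop_eq_Cons[of kzero "u # t"] hop_eq_Cons[of v "kzero # u # t"]
          by (simp add: unshear_def)
        ultimately show ?thesis
          using True d s by (intro thesisI[of "kzero # u # t"]) simp_all
      next
        \<comment> \<open>The only case with a cancellation: \<open>toggle\<close> removes the
          leading \<open>kzero\<close>, and the \<open>u\<close> behind it survives because
          \<open>u\<close> differs from \<open>v\<close>.\<close>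
        case d: False
        then have "u \<noteq> v"
          using u l True \<open>m \<noteq> letter_inv l\<close> by (auto simp: letter_inv_def)
        then have "distinct_adj (kzero # u # t)" "distinct_adj (v # u # t)"
          using dist s v u d by (auto simp: distinct_adj_Cons)
        moreover from this have "unshear v (kzero # u # t) = v # u # t"
          using hop_Cons[of kzero "u # t"] hop_eq_Cons[of v "u # t"]
          by (simp add: unshear_def)
        ultimately show ?thesis
          using True d s by (intro thesisI[of "u # t"]) simp_all
      qed
    qed
  qed
qed simp

lemma shears_free:
  assumes "ws \<in> words_over shears" "ws \<noteq> []" "reduced_word ws"
  shows "word_val listperms ws \<noteq> \<one>\<^bsub>listperms\<^esub>"
  using reduced_word_in_shears[OF assms(1,3,2)] by (auto simp: one_BijGroup_UNIV split: if_splits)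

text \<open>Induction from the right needs no conjugation of \<open>q\<close>.\<close>
lemma leaf_word:
  "\<exists>q\<in>generate listperms shears. \<exists>k e. \<forall>s v d. word_act leaf_act t (s, v, d) =
     (q ((if e then toggle else id) (map (kadd k) s)), kadd k v, d \<noteq> e)"
proof (induction t rule: rev_induct)
  case Nil
  have "id \<in> generate listperms shears"
    using generate.one[of listperms shears] by (simp add: one_BijGroup_UNIV)
  then show ?case
    by (intro bexI[of _ id] exI[of _ kzero] exI[of _ False]) auto
next
  case (snoc l t)
  interpret group listperms by (rule group_BijGroup)
  obtain q k e where q: "q \<in> generate listperms shears"
    and t: "\<And>s v d. word_act leaf_act t (s, v, d) =
     (q ((if e then toggle else id) (map (kadd k) s)), kadd k v, d \<noteq> e)"
    using snoc by blast
  have bij: "bij g" if "g \<in> generate listperms shears" for g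
    using generate_in_carrier[OF shears_carrier that] by (simp add: carrier_BijGroup_UNIV)
  have comp: "q \<circ> g \<in> generate listperms shears" if "g \<in> generate listperms shears" for g
    using generate.eng[OF q that] bij[OF q] bij[OF that] by (simp add: mult_BijGroup_UNIV)
  have shear: "shear k \<in> generate listperms shears" "unshear k \<in> generate listperms shears"
  proof -
    have "shear k \<in> generate listperms shears \<and> unshear k \<in> generate listperms shears"
    proof (cases "k = kzero")
      case True
      then have "shear k = \<one>\<^bsub>listperms\<^esub>" "unshear k = \<one>\<^bsub>listperms\<^esub>"
        by (auto simp: shear_def unshear_def one_BijGroup_UNIV)
      then show ?thesis by (metis generate.one)
    next
      case False
      then have "shear k \<in> shears" by (auto simp: shears_def)
      then show ?thesis
        using generate.incl generate.inv inv_shear by metis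
    qed
    then show "shear k \<in> generate listperms shears" "unshear k \<in> generate listperms shears" by auto
  qed
  show ?case
  proof (cases l)
    case A
    \<comment> \<open>Moving the new \<open>toggle\<close> to the left past \<open>kadd k\<close>
      turns it into \<open>hop k\<close>. If \<open>e\<close> holds, it joins the old
      \<open>toggle\<close> to form \<open>shear k\<close>; otherwise \<open>hop k\<close> equals
      \<open>unshear k\<close> followed on the right by a fresh \<open>toggle\<close>.\<close>
    define g where "g = (if e then shear k else unshear k)"
    have "q \<circ> g \<in> generate listperms shears"
      using comp shear by (simp add: g_def)
    moreover have "word_act leaf_act (t @ [l]) (s, v, d) =
      ((q \<circ> g) ((if \<not> e then toggle else id) (map (kadd k) s)), kadd k v, d \<noteq> (\<not> e))" for s v d
      by (auto simp: A t g_def shear_def unshear_def map_kadd_toggle)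
    ultimately show ?thesis by blast
  next
    case (V u)
    have "word_act leaf_act (t @ [l]) (s, v, d) =
      (q ((if e then toggle else id) (map (kadd (kadd k u)) s)), kadd (kadd k u) v, d \<noteq> e)" for s v d
      by (simp add: V t kadd_assoc)
    with q show ?thesis by blast
  qed
qed

subsection \<open>Stabilizers of vertices\<close>

text \<open>Forgetting the reduced word leaves a vertex and an element of
  \<open>V\<^sub>4 \<times> C\<^sub>2\<close>. For vertices of a fixed length this is finite data,
  so stabilizers of blocks have finite index.\<close>

definition block :: "bool list \<times> leaf \<Rightarrow> bool list \<times> klein \<times> bool" where
  "block p = (fst p, snd (snd p))"

text \<open>No letter lets the reduced word in a leaf influence the other coordinates, so the action
  descends to blocks.\<close>

lemma block_act:
  assumes "block p = block q"
  shows "block (act n w l p) = block (act n w l q)"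
proof -
  have leaf: "snd (leaf_act l y) = snd (leaf_act l y')" if "snd y = snd y'" for l y y'
    using that by (cases y; cases y'; cases l) auto
  have cons: "apfst (Cons x) r = (x # fst r, snd r)" for x and r :: "bool list \<times> leaf"
    by (cases r) auto
  obtain u y y' where p: "p = (u, y)" and q: "q = (u, y')" and y: "snd y = snd y'"
    using assms by (cases p; cases q) (auto simp: block_def)
  show ?thesis
    unfolding p q
  proof (induction n arbitrary: w l u)
    case 0
    then show ?case
      using leaf[OF y] by (simp add: block_def)
  next
    case (Suc n)
    show ?case
    proof (cases u)
      case Nil
      then show ?thesis using y by (simp add: block_def)
    next
      case (Cons x v)
      then show ?thesis
        using Suc.IH[of "shift w" A v] Suc.IH[of "shift w" l v] y
        by (cases l; cases x) (auto simp: block_def cons)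
    qed
  qed
qed

lemma block_act_word:
  "block p = block q \<Longrightarrow> block (word_act (act n w) z p) = block (word_act (act n w) z q)"
  by (induction z) (auto intro: block_act)

text \<open>Here \<open>t\<close> is the section of \<open>z\<close> at \<open>u\<close>. The depth
  equals the length of \<open>u\<close>, so this section acts on the leaf alone.\<close>

lemma act_word_vertex:
  "\<exists>v t. length v = length u \<and> (\<forall>y. word_act (act (length u) w) z (u, y) = (v, word_act leaf_act t y))"
proof (induction u arbitrary: w z)
  case Nil
  have "word_act (act 0 w) z ([], y) = ([], word_act leaf_act z y)" for y
    by (induction z) auto
  then show ?case by auto
next
  case (Cons x u)
  obtain v t where vt: "length v = length u"
    "\<And>y. word_act (act (length u) (shift w)) (section_word (w 0) z x) (u, y) = (v, word_act leaf_act t y)"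
    using Cons by blast
  show ?case
    by (rule exI[of _ "word_act swap_letter z x # v"], rule exI[of _ t])
      (use vt in \<open>simp add: act_section\<close>)
qed

text \<open>Each level is climbed by a substitution on words that fixes the vertex
  \<open>True\<close> and whose section there is the given word.\<close>

lemma act_word_vertex_onto:
  assumes "w \<in> Omega"
  shows "\<exists>z. \<forall>y. word_act (act n w) z (replicate n True, y) = (replicate n True, word_act leaf_act t y)"
  using assms
proof (induction n arbitrary: w)
  case 0
  have "word_act (act 0 w) t ([], y) = ([], word_act leaf_act t y)" for y
    by (induction t) auto
  then show ?case by auto
next
  case (Suc n)
  have "shift w \<in> Omega"
    using Suc.prems by (auto simp: Omega_def shift_def)
  then obtain z where z: "\<And>y. word_act (act n (shift w)) z (replicate n True, y) =
      (replicate n True, word_act leaf_act t y)"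
    using Suc.IH by blast
  obtain v where v: "chi (w 0) v"
    using ex_chi[of "w 0"] Suc.prems by (auto simp: Omega_def)
  \<comment> \<open>\<open>V v\<close> has section \<open>A\<close> at \<open>False\<close>;
    conjugation by \<open>A\<close> moves it to \<open>True\<close>. The letters \<open>V u\<close>
    reproduce themselves at \<open>True\<close>.\<close>
  define lift where "lift l = (if l = A then [A, V v, A] else [l])" for l
  have lift: "lift A = [A, V v, A]" "lift (V u) = [V u]" for u
    by (simp_all add: lift_def)
  have swap: "word_act swap_letter (concat (map lift z)) True = True" for z
  proof (induction z)
    case (Cons l z)
    then show ?case
      by (cases l) (simp_all add: lift)
  qed simp
  have "section_word (w 0) (concat (map lift z)) True = z" for z
  proof (induction z)
    case (Cons l z)
    then show ?case
      by (cases l) (simp_all add: lift swap v)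
  qed simp
  then have "word_act (act (Suc n) w) (concat (map lift z)) (replicate (Suc n) True, y) =
      (replicate (Suc n) True, word_act leaf_act t y)" for y
    by (simp add: act_section swap z)
  then show ?case by blast
qed

text \<open>The orbit-stabilizer argument for the action induced on the values of
  \<open>\<beta>\<close>.\<close>

lemma finite_index_of_action:
  fixes \<theta> :: "'g \<Rightarrow> 'x \<Rightarrow> 'x" and \<beta> :: "'x \<Rightarrow> 'b"
  assumes "group G"
    and mult: "\<And>g h. g \<in> carrier G \<Longrightarrow> h \<in> carrier G \<Longrightarrow> \<theta> (g \<otimes>\<^bsub>G\<^esub> h) = \<theta> g \<circ> \<theta> h"
    and one: "\<theta> \<one>\<^bsub>G\<^esub> = id"
    and cong: "\<And>g p q. g \<in> carrier G \<Longrightarrow> \<beta> p = \<beta> q \<Longrightarrow> \<beta> (\<theta> g p) = \<beta> (\<theta> g q)"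
    and fin: "finite ((\<lambda>g. \<beta> (\<theta> g p)) ` carrier G)"
  defines "H \<equiv> {g \<in> carrier G. \<beta> (\<theta> g p) = \<beta> p}"
  shows "subgroup H G" and "finite (rcosets\<^bsub>G\<^esub> H)"
proof -
  interpret group G by fact
  have inv: "\<theta> (inv\<^bsub>G\<^esub> g) (\<theta> g x) = x" "\<theta> g (\<theta> (inv\<^bsub>G\<^esub> g) x) = x" if "g \<in> carrier G" for g x
    using mult[of "inv\<^bsub>G\<^esub> g" g] mult[of g "inv\<^bsub>G\<^esub> g"] that one
    by (auto simp: fun_eq_iff)
  show H: "subgroup H G"
  proof (rule subgroupI)
    show "H \<noteq> {}"
      using one by (auto simp: H_def intro!: exI[of _ "\<one>\<^bsub>G\<^esub>"])
    show "inv\<^bsub>G\<^esub> g \<in> H" if "g \<in> H" for g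
      using that cong[of "inv\<^bsub>G\<^esub> g" "\<theta> g p" p] inv(1)[of g p] by (auto simp: H_def)
    show "g \<otimes>\<^bsub>G\<^esub> h \<in> H" if "g \<in> H" "h \<in> H" for g h
      using that cong[of g "\<theta> h p" p] mult[of g h] by (auto simp: H_def)
  qed (auto simp: H_def)
  \<comment> \<open>The inverse is due to right cosets: \<open>g\<close> and \<open>h\<close> lie in
    the same one as soon as their inverses send \<open>p\<close> to the same value of
    \<open>\<beta>\<close>.\<close>
  let ?k = "\<lambda>g. \<beta> (\<theta> (inv\<^bsub>G\<^esub> g) p)"
  have eq: "H #>\<^bsub>G\<^esub> g = H #>\<^bsub>G\<^esub> h"
    if "g \<in> carrier G" "h \<in> carrier G" "?k g = ?k h" for g h
  proof -
    have "\<beta> (\<theta> (h \<otimes>\<^bsub>G\<^esub> inv\<^bsub>G\<^esub> g) p) = \<beta> p"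
      using that mult[of h "inv\<^bsub>G\<^esub> g"] inv(2)[of h p]
        cong[of h "\<theta> (inv\<^bsub>G\<^esub> g) p" "\<theta> (inv\<^bsub>G\<^esub> h) p"]
      by simp
    then have "h \<otimes>\<^bsub>G\<^esub> inv\<^bsub>G\<^esub> g \<in> H"
      using that by (simp add: H_def)
    moreover have "h = (h \<otimes>\<^bsub>G\<^esub> inv\<^bsub>G\<^esub> g) \<otimes>\<^bsub>G\<^esub> g"
      using that by (simp add: m_assoc)
    ultimately have "h \<in> H #>\<^bsub>G\<^esub> g"
      by (auto simp: r_coset_def)
    then show ?thesis
      using repr_independence that H by blast
  qed
  have "?k ` carrier G \<subseteq> (\<lambda>g. \<beta> (\<theta> g p)) ` carrier G"
    by auto
  then have "finite (?k ` carrier G)"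
    using fin finite_subset by blast
  moreover have "rcosets\<^bsub>G\<^esub> H \<subseteq>
      (\<lambda>b. H #>\<^bsub>G\<^esub> inv_into (carrier G) ?k b) ` (?k ` carrier G)"
  proof
    fix c assume "c \<in> rcosets\<^bsub>G\<^esub> H"
    then obtain g where g: "g \<in> carrier G" "c = H #>\<^bsub>G\<^esub> g"
      by (auto simp: RCOSETS_def)
    let ?h = "inv_into (carrier G) ?k (?k g)"
    have "?h \<in> carrier G" "?k ?h = ?k g"
      using g(1) by (auto intro: inv_into_into f_inv_into_f[of _ ?k])
    then have "c = H #>\<^bsub>G\<^esub> ?h"
      using eq[of g ?h] g by simp
    then show "c \<in> (\<lambda>b. H #>\<^bsub>G\<^esub> inv_into (carrier G) ?k b) ` (?k ` carrier G)"
      using g(1) by blast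
  qed
  ultimately show "finite (rcosets\<^bsub>G\<^esub> H)"
    using finite_surj by blast
qed

section \<open>The elements of \<open>G_omega w\<close> as words\<close>

lemma G_omega_imp_word:
  assumes "g \<in> carrier (G_omega w)"
  shows "\<exists>z. g = word_act (tree_letter w) z"
proof -
  have bij: "bij (word_act (tree_letter w) z)" for z
    by (rule o_bij[of "word_act (tree_letter w) (rev z)"])
      (simp_all add: word_act_rev word_act_rev' tree_letter_involution)
  have letter: "\<exists>l. h = tree_letter w l" if "h \<in> {tree_a, tree_b w, tree_c w, tree_d w}" for h
    using that tree_letter_generators[of w] tree_letter.simps(1)[of w]
    by (metis empty_iff insert_iff)
  have "g \<in> generate (BijGroup UNIV) (carrier (BijGroup UNIV) \<inter> {tree_a, tree_b w, tree_c w, tree_d w})"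
    using assms by (simp add: G_omega_def carrier_subgroup_generated)
  then show ?thesis
  proof induction
    case one
    show ?case
      by (rule exI[of _ "[]"]) (simp add: one_BijGroup_UNIV)
  next
    case (incl h)
    then obtain l where "h = tree_letter w l" using letter by blast
    then show ?case
      by (intro exI[of _ "[l]"]) simp
  next
    case (inv h)
    then obtain l where h: "h = tree_letter w l" using letter by blast
    \<comment> \<open>Generators are involutions, so an inverse is again a one-letter word.\<close>
    have "inv\<^bsub>BijGroup UNIV\<^esub> h = h"
    proof (rule group.inv_equality[OF group_BijGroup])
      show "h \<otimes>\<^bsub>BijGroup UNIV\<^esub> h = \<one>\<^bsub>BijGroup UNIV\<^esub>"
        using inv h tree_letter_involution[of w l]
        by (simp add: mult_BijGroup_UNIV carrier_BijGroup_UNIV one_BijGroup_UNIV)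
    qed (use inv in auto)
    with h show ?case
      by (intro exI[of _ "[l]"]) simp
  next
    case (eng g h)
    then obtain y z where yz: "g = word_act (tree_letter w) y" "h = word_act (tree_letter w) z"
      by blast
    show ?case
      unfolding yz mult_BijGroup_UNIV[OF bij bij]
      by (rule exI[of _ "y @ z"]) simp
  qed
qed

lemma bij_tree_letter: "bij (tree_letter w l)"
  using tree_letter_involution by (rule o_bij) (rule tree_letter_involution)

lemma tree_letter_in_G_omega: "tree_letter w l \<in> carrier (G_omega w)"
proof -
  have incl: "h \<in> carrier (G_omega w)" if "h \<in> {tree_a, tree_b w, tree_c w, tree_d w}" "bij h" for h
    using that
    by (auto simp: G_omega_def carrier_subgroup_generated carrier_BijGroup_UNIV intro!: generate.incl)
  have "tree_letter w (V kzero) = \<one>\<^bsub>BijGroup UNIV\<^esub>"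
    by (simp add: tree_letter_kzero one_BijGroup_UNIV del: tree_letter.simps)
  then have zero: "tree_letter w (V kzero) \<in> carrier (G_omega w)"
    by (simp add: G_omega_def carrier_subgroup_generated generate.one del: tree_letter.simps)
  show ?thesis
  proof (cases l)
    case A
    then show ?thesis
      using incl[of tree_a] bij_tree_letter[of w A] by simp
  next
    case (V v)
    then show ?thesis
      using zero incl[of "tree_letter w l"] bij_tree_letter[of w l] tree_letter_generators[of w]
      by (cases v; cases "fst v"; cases "snd v") (auto simp del: tree_letter.simps)
  qed
qed

section \<open>The stabilizer of a block and its free quotient\<close>

theorem theorem1p10:
  fixes w :: "nat \<Rightarrow> nat"
    and \<Gamma> :: "('g, 'c) monoid_scheme"
    and \<phi> :: "'g \<Rightarrow> (bool list \<Rightarrow> bool list)"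
  assumes "w \<in> Omega_plus"
    and "group \<Gamma>"
    and "finitely_presented \<Gamma>"
    and "\<phi> \<in> hom \<Gamma> (G_omega w)"
    and "\<phi> ` carrier \<Gamma> = carrier (G_omega w)"
  shows "large \<Gamma>"
proof -
  interpret group \<Gamma> by fact
  have word: "\<exists>z. \<phi> g = word_act (tree_letter w) z" if "g \<in> carrier \<Gamma>" for g
    using G_omega_imp_word assms(5) that by blast
  have bij: "bij (\<phi> g)" if "g \<in> carrier \<Gamma>" for g
  proof -
    have "\<phi> g \<in> carrier (subgroup_generated (BijGroup UNIV) {tree_a, tree_b w, tree_c w, tree_d w})"
      using assms(5) that by (auto simp: G_omega_def)
    then have "\<phi> g \<in> carrier (BijGroup UNIV)"
      using group.carrier_subgroup_generated_subset[OF group_BijGroup] by blast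
    then show ?thesis by (simp add: carrier_BijGroup_UNIV)
  qed
  have mult: "\<phi> (g \<otimes>\<^bsub>\<Gamma>\<^esub> h) = \<phi> g \<circ> \<phi> h" if "g \<in> carrier \<Gamma>" "h \<in> carrier \<Gamma>" for g h
    using hom_mult[OF assms(4) that] bij that by (simp add: G_omega_def mult_BijGroup_UNIV)
  have onto: "\<exists>g\<in>carrier \<Gamma>. \<phi> g = tree_letter w l" for l
    using tree_letter_in_G_omega[of w l] assms(5) by (metis imageE)
  have "\<exists>n \<theta>. (\<forall>g\<in>carrier \<Gamma>. \<forall>h\<in>carrier \<Gamma>. \<theta> (g \<otimes>\<^bsub>\<Gamma>\<^esub> h) = \<theta> g \<circ> \<theta> h) \<and>
    (\<forall>g\<in>carrier \<Gamma>. \<exists>z. \<theta> g = word_act (act n w) z) \<and>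
    (\<forall>l. \<exists>g\<in>carrier \<Gamma>. \<theta> g = act n w l)"
    by (rule finitely_presented_acts[OF assms(1-3)]) (rule mult word onto; assumption)+
  then obtain n \<theta> where
    *: "\<forall>g\<in>carrier \<Gamma>. \<forall>h\<in>carrier \<Gamma>. \<theta> (g \<otimes>\<^bsub>\<Gamma>\<^esub> h) = \<theta> g \<circ> \<theta> h"
    "\<forall>g\<in>carrier \<Gamma>. \<exists>z. \<theta> g = word_act (act n w) z"
    and \<theta>_onto: "\<forall>l. \<exists>g\<in>carrier \<Gamma>. \<theta> g = act n w l"
    by blast
  have \<theta>_mult: "\<theta> (g \<otimes>\<^bsub>\<Gamma>\<^esub> h) = \<theta> g \<circ> \<theta> h" if "g \<in> carrier \<Gamma>" "h \<in> carrier \<Gamma>" for g h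
    using *(1) that by blast
  have \<theta>_word: "\<exists>z. \<theta> g = word_act (act n w) z" if "g \<in> carrier \<Gamma>" for g
    using *(2) that by blast
  have \<theta>_one: "\<theta> \<one>\<^bsub>\<Gamma>\<^esub> = id"
    using word_action_one[of \<Gamma> "act n w" \<theta>] assms(2) act_involution \<theta>_mult \<theta>_word by blast
  have \<theta>_onto_word: "\<exists>g\<in>carrier \<Gamma>. \<theta> g = word_act (act n w) z" for z
  proof (induction z)
    case Nil
    show ?case
      using \<theta>_one by (intro bexI[of _ "\<one>\<^bsub>\<Gamma>\<^esub>"]) auto
  next
    case (Cons l z)
    then show ?case
      using \<theta>_onto \<theta>_mult by (metis m_closed word_act.simps(2))
  qed
  define p where "p s = (replicate n True, s, kzero, False)" for s :: "klein list"
  \<comment> \<open>Membership in \<open>H\<close> means fixing the vertex of \<open>n\<close>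
    letters \<open>True\<close> and having a section there with trivial image in
    \<open>V\<^sub>4 \<times> C\<^sub>2\<close>.\<close>
  define H where "H = {g \<in> carrier \<Gamma>. block (\<theta> g (p [])) = block (p [])}"
  have cong: "block (\<theta> g x) = block (\<theta> g y)" if "g \<in> carrier \<Gamma>" "block x = block y" for g x y
    using \<theta>_word[OF that(1)] block_act_word[OF that(2)] by metis
  have vertex: "\<exists>v t. length v = n \<and> (\<forall>y. \<theta> g (replicate n True, y) = (v, word_act leaf_act t y))"
    if "g \<in> carrier \<Gamma>" for g
    using \<theta>_word[OF that] act_word_vertex[of "replicate n True" w] by fastforce
  have "(\<lambda>g. block (\<theta> g (p []))) ` carrier \<Gamma> \<subseteq> {v. set v \<subseteq> UNIV \<and> length v = n} \<times> UNIV"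
    using vertex by (fastforce simp: p_def block_def)
  then have fin: "finite ((\<lambda>g. block (\<theta> g (p []))) ` carrier \<Gamma>)"
    by (rule finite_subset) (intro finite_cartesian_product finite_lists_length_eq finite)
  have H: "subgroup H \<Gamma>" "finite (rcosets\<^bsub>\<Gamma>\<^esub> H)"
    unfolding H_def
    using finite_index_of_action[OF assms(2) \<theta>_mult \<theta>_one cong fin] by blast+
  \<comment> \<open>The points \<open>p s\<close> form the block stabilized by \<open>H\<close>;
    \<open>\<psi>\<close> is the action of \<open>H\<close> on it, read off in the coordinate
    \<open>s\<close>.\<close>
  define \<psi> where "\<psi> g s = fst (snd (\<theta> g (p s)))" for g s
  have block_p: "block q = block (p []) \<longleftrightarrow> (\<exists>s. q = p s)" for q
    by (cases q) (auto simp: block_def p_def)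
  have \<theta>_p: "\<theta> g (p s) = p (\<psi> g s)" if "g \<in> H" for g s
  proof -
    have "block (\<theta> g (p s)) = block (p [])"
      using that cong[of g "p s" "p []"] block_p[of "p s"] by (auto simp: H_def)
    then show ?thesis
      unfolding block_p \<psi>_def by (auto simp: p_def)
  qed
  have \<psi>_mult: "\<psi> (g \<otimes>\<^bsub>\<Gamma>\<^esub> h) = \<psi> g \<circ> \<psi> h" if "g \<in> H" "h \<in> H" for g h
  proof
    fix s
    have "g \<in> carrier \<Gamma>" "h \<in> carrier \<Gamma>"
      using that by (auto simp: H_def)
    then have "\<theta> (g \<otimes>\<^bsub>\<Gamma>\<^esub> h) (p s) = p (\<psi> g (\<psi> h s))"
      by (simp add: \<theta>_mult \<theta>_p that)
    then show "\<psi> (g \<otimes>\<^bsub>\<Gamma>\<^esub> h) s = (\<psi> g \<circ> \<psi> h) s"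
      by (simp add: \<psi>_def p_def)
  qed
  interpret L: group listperms by (rule group_BijGroup)
  have \<psi>_in: "\<psi> g \<in> generate listperms shears" if g: "g \<in> H" for g
  proof -
    obtain v t where t: "\<And>y. \<theta> g (replicate n True, y) = (v, word_act leaf_act t y)"
      using vertex g unfolding H_def by blast
    obtain q k e where q: "q \<in> generate listperms shears"
      and leaf: "\<And>s v d. word_act leaf_act t (s, v, d) =
        (q ((if e then toggle else id) (map (kadd k) s)), kadd k v, d \<noteq> e)"
      using leaf_word[of t] by blast
    have \<theta>_t: "\<theta> g (p s) = (v, q ((if e then toggle else id) (map (kadd k) s)), k, e)" for s
      using t leaf by (simp add: p_def)
    \<comment> \<open>Stabilizing the block kills the part of the section outside the group
      generated by the shears.\<close>
    have "k = kzero" "\<not> e"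
      using \<theta>_p[OF g, of "[]"] \<theta>_t[of "[]"] by (auto simp: p_def)
    then have "\<psi> g = q"
      using \<theta>_t by (auto simp: \<psi>_def)
    with q show ?thesis by simp
  qed
  have gen_bij: "bij f" if "f \<in> generate listperms shears" for f
    using L.generate_in_carrier[OF shears_carrier that] by (simp add: carrier_BijGroup_UNIV)
  let ?H = "\<Gamma>\<lparr>carrier := H\<rparr>"
  have H_group: "group ?H"
    using H(1) subgroup_imp_group by blast
  have hom: "\<psi> \<in> hom ?H listperms"
    using \<psi>_in gen_bij by (auto simp: hom_def carrier_BijGroup_UNIV mult_BijGroup_UNIV \<psi>_mult)
  interpret \<Psi>: group_hom ?H listperms \<psi>
    using H_group hom by (simp add: group_hom_def group_hom_axioms_def L.is_group)
  have shear_in: "shear v \<in> \<psi> ` H" for v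
  proof -
    \<comment> \<open>The commutator word realizes \<open>shear v\<close> and fixes the other two
      coordinates, so a preimage of it in \<open>\<Gamma>\<close> lies in \<open>H\<close>.\<close>
    have leaf: "word_act leaf_act [A, V v, A, V v] (s, kzero, False) = (shear v s, kzero, False)" for s
      by (simp add: shear_def hop_def)
    have "w \<in> Omega"
      using assms(1) by (simp add: Omega_plus_def)
    then obtain z where z: "\<And>y. word_act (act n w) z (replicate n True, y) =
        (replicate n True, word_act leaf_act [A, V v, A, V v] y)"
      using act_word_vertex_onto by blast
    obtain g where g: "g \<in> carrier \<Gamma>" "\<theta> g = word_act (act n w) z"
      using \<theta>_onto_word by blast
    have \<theta>_g: "\<theta> g (p s) = p (shear v s)" for s
      unfolding p_def g(2) z leaf ..
    then have "g \<in> H"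
      using g(1) block_p by (auto simp: H_def)
    moreover have "\<psi> g = shear v"
      by (rule ext) (simp add: \<psi>_def \<theta>_g, simp add: p_def)
    ultimately show ?thesis by (metis imageI)
  qed
  have "generate listperms shears \<subseteq> \<psi> ` carrier ?H"
    using shear_in by (intro L.generate_subgroup_incl \<Psi>.img_is_subgroup) (auto simp: shears_def)
  with \<psi>_in have img: "\<psi> ` carrier ?H = generate listperms shears"
    by auto
  \<comment> \<open>Two distinct basis elements make the free image non-abelian.\<close>
  have "shear (True, False) [] \<noteq> shear (False, True) []"
    using hop_eq_Cons[of "(True, False)" "[]"] hop_eq_Cons[of "(False, True)" "[]"]
    by (simp add: shear_def toggle_def)
  then have "shear (True, False) \<noteq> shear (False, True)" by auto
  from nonabelian_free_quotient[OF H_group L.is_group hom img shears_carrier _ _ this shears_free]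
  have "kernel ?H listperms \<psi> \<lhd> ?H \<and> nonabelian_free_group (?H Mod (kernel ?H listperms \<psi>))"
    by (simp add: shears_def)
  with H show ?thesis
    unfolding large_def by blast
qed

end
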